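(* Let $A\in\mathbb{R}\setminus\{0\}$ and $B,a_0,b_0\in\mathbb{R}$ with $a_0+b_0=B$, and put $a(\epsilon)=a_0+\frac{A}{\epsilon}$, $b(\epsilon)=b_0-\frac{A}{\epsilon}$ for $\epsilon\in(0,1]$; assume $b(\epsilon)\ne0$ for all $\epsilon\in(0,1]$. Let $L>0$, let $0\neq\psi\in L^2(\mathbb{R},dx)$ have support contained in $[-L,L]$, let $p_0=\frac{\pi}{AL}$ and let $q_0\in\mathbb{R}$ satisfy $|q_0p_0|<2\pi$. Suppose there is a constant $\chi>0$ with $\sum_{n\in\mathbb{Z}}|\psi(x+nq_0)|^2=\chi$ for all $x\in\mathbb{R}$. Then for any $x\in\mathbb{R}$ and $(n,m)\in\mathbb{Z}^2$, $$\lim_{\epsilon\to0^+}|\psi^{\epsilon,a(\epsilon),b(\epsilon)}_{(n,m)}\rangle(x)=|\psi^{A,B}_{(n,m)}\rangle(x)$$ and $$\lim_{\epsilon\to0^+}|\psi^{\epsilon,a(\epsilon),b(\epsilon)}_{(n,m)}\rangle=|\psi^{A,B}_{(n,m)}\rangle\quad\text{in } L^2(\mathbb{R},dx),$$ i.e., the convergence is pointwise and in norm.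
   Context: Heisenberg side: $\eta^{A,B}$ is the representation on $L^2(\mathbb{R})$ of the Heisenberg group $H$ ($\mathbb{R}\times\mathbb{R}^2$ with product $(x_1,(y_1,z_1))(x_2,(y_2,z_2))=(x_1+x_2,(y_1+y_2+x_1z_2,z_1+z_2))$) given by $(\eta^{A,B}(c,(v_1,v_2))f)(x)=e^{i[A(v_1+xv_2)+Bv_2]}f(c+x)$, and $|\psi^{A,B}_{(n,m)}\rangle=\eta^{A,B}\big(nq_0,(\tfrac{nq_0mp_0}{2},mp_0)\big)\psi$. Extended affine side: for $\epsilon\in(0,1]$, $a\in\mathbb{R}$, $b\ne0$, $\rho_\epsilon^{a,b}$ is the representation on $L^2(\mathbb{R})$ of $EA=\mathbb{R}^+\times\mathbb{R}\times\mathbb{R}$ (product $(\alpha,\beta,\gamma)(x,y,z)=(\alpha x,\alpha y+\beta,\gamma+z)$) given by $(\rho_\epsilon^{a,b}(\alpha,\beta,\gamma)f)(x)=e^{ia\gamma}e^{ib\beta e^{-\epsilon x}}f\big(x-\tfrac{\log\alpha}{\epsilon}\big)$. Put $\alpha_n(\epsilon)=e^{-\epsilon nq_0}$, $\beta_{mn}(\epsilon)=-\frac{2\pi m\,e^{-\epsilon nq_0}}{b(\epsilon)(e^{\epsilon L}-e^{-\epsilon L})}$, $\gamma_{mn}(\epsilon)=\beta_{mn}(\epsilon)\frac{\ln\alpha_n(\epsilon)}{\alpha_n(\epsilon)-1}$ (the quotient is $1$ when $\alpha_n(\epsilon)=1$), $Q_\epsilon(x)=e^{-\frac12\epsilon x}$,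 and $|\psi^{\epsilon,a(\epsilon),b(\epsilon)}_{(n,m)}\rangle=\rho_\epsilon^{a(\epsilon),b(\epsilon)}(\alpha_n(\epsilon),\beta_{mn}(\epsilon),\gamma_{mn}(\epsilon))(Q_\epsilon\psi)$. In the pointwise statement, $\psi$ is a fixed function and the representations act by the displayed formulas. *)

theory Defs
  imports "HOL-Analysis.Analysis"
begin

text \<open>
  Elements of \<open>L\<^sup>2(\<real>, dx)\<close> are represented by functions \<open>\<real> \<rightarrow> \<complex>\<close> (not by classes modulo
  almost-everywhere equality), since both a pointwise limit and a norm limit are considered.
\<close>

definition in_L2 :: "(real \<Rightarrow> complex) \<Rightarrow> bool" where
  "in_L2 f \<longleftrightarrow> f \<in> borel_measurable lebesgue \<and> integrable lebesgue (\<lambda>x. (norm (f x))\<^sup>2)"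

definition norm_L2 :: "(real \<Rightarrow> complex) \<Rightarrow> real" where
  "norm_L2 f = sqrt (\<integral>x. (norm (f x))\<^sup>2 \<partial>lebesgue)"

text \<open>
  The membership conditions are needed because the Bochner integral of a
  non-integrable function is \<open>0\<close>.
\<close>

definition tendsto_L2 :: "('a \<Rightarrow> real \<Rightarrow> complex) \<Rightarrow> (real \<Rightarrow> complex) \<Rightarrow> 'a filter \<Rightarrow> bool" where
  "tendsto_L2 f g F \<longleftrightarrow>
     (\<forall>\<^sub>F t in F. in_L2 (f t)) \<and> in_L2 g \<and> ((\<lambda>t. norm_L2 (\<lambda>x. f t x - g x)) \<longlongrightarrow> 0) F"

definition ess_supported_in :: "(real \<Rightarrow> complex) \<Rightarrow> real set \<Rightarrow> bool" where
  "ess_supported_in f S \<longleftrightarrow> (AE x in lebesgue. x \<notin> S \<longrightarrow> f x = 0)"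


type_synonym heis = "real \<times> real \<times> real"

fun heis_mult :: "heis \<Rightarrow> heis \<Rightarrow> heis" where
  "heis_mult (x1, y1, z1) (x2, y2, z2) = (x1 + x2, y1 + y2 + x1 * z2, z1 + z2)"

fun eta :: "real \<Rightarrow> real \<Rightarrow> heis \<Rightarrow> (real \<Rightarrow> complex) \<Rightarrow> real \<Rightarrow> complex" where
  "eta A B (c, v1, v2) f x =
     exp (\<i> * complex_of_real (A * (v1 + x * v2) + B * v2)) * f (c + x)"

lemma eta_mult: "eta A B (heis_mult g h) f = eta A B g (eta A B h f)"
proof (cases g; cases h)
  fix c v1 v2 c' w1 w2 assume g: "g = (c, v1, v2)" and h: "h = (c', w1, w2)"
  show ?thesis
    unfolding g h heis_mult.simps
    by (rule ext) (simp only: eta.simps of_real_add distrib_left distrib_right exp_add mult_ac add_ac)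
qed

definition heis_state ::
  "real \<Rightarrow> real \<Rightarrow> real \<Rightarrow> real \<Rightarrow> (real \<Rightarrow> complex) \<Rightarrow> int \<Rightarrow> int \<Rightarrow> real \<Rightarrow> complex" where
  "heis_state A B q0 p0 \<psi> n m =
     eta A B (of_int n * q0, (of_int n * q0 * (of_int m * p0)) / 2, of_int m * p0) \<psi>"


text \<open>
  The underlying set of the extended affine group is \<open>{(\<alpha>, \<beta>, \<gamma>). \<alpha> > 0}\<close>; this constraint is not
  part of the type.
\<close>

type_synonym ea = "real \<times> real \<times> real"

fun ea_mult :: "ea \<Rightarrow> ea \<Rightarrow> ea" where
  "ea_mult (\<alpha>, \<beta>, \<gamma>) (x, y, z) = (\<alpha> * x, \<alpha> * y + \<beta>, \<gamma> + z)"

fun rho :: "real \<Rightarrow> real \<Rightarrow> real \<Rightarrow> ea \<Rightarrow> (real \<Rightarrow> complex) \<Rightarrow> real \<Rightarrow> complex" where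
  "rho \<epsilon> a b (\<alpha>, \<beta>, \<gamma>) f x =
     exp (\<i> * complex_of_real (a * \<gamma>)) *
     exp (\<i> * complex_of_real (b * \<beta> * exp (- \<epsilon> * x))) * f (x - ln \<alpha> / \<epsilon>)"

lemma rho_mult:
  assumes "\<epsilon> > 0" "fst g > 0" "fst h > 0"
  shows "rho \<epsilon> a b (ea_mult g h) f = rho \<epsilon> a b g (rho \<epsilon> a b h f)"
proof (cases g; cases h)
  fix \<alpha> \<beta> \<gamma> x y z assume g: "g = (\<alpha>, \<beta>, \<gamma>)" and h: "h = (x, y, z)"
  have pos: "\<alpha> > 0" "x > 0" using assms g h by auto
  have *: "exp (- \<epsilon> * (t - ln \<alpha> / \<epsilon>)) = \<alpha> * exp (- \<epsilon> * t)" for t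
  proof -
    have "- \<epsilon> * (t - ln \<alpha> / \<epsilon>) = ln \<alpha> + - \<epsilon> * t"
      using assms by (simp add: field_simps)
    then show ?thesis using pos by (simp only: exp_add exp_ln)
  qed
  have shift: "t - ln (\<alpha> * x) / \<epsilon> = t - ln \<alpha> / \<epsilon> - ln x / \<epsilon>" for t
    using pos by (simp add: ln_mult add_divide_distrib)
  have phase1: "a * (\<gamma> + z) = a * \<gamma> + a * z"
    by algebra
  have phase2: "b * (\<alpha> * y + \<beta>) * e = b * \<beta> * e + b * y * (\<alpha> * e)" for e
    by algebra
  show ?thesis
    unfolding g h ea_mult.simps
    by (rule ext)
      (simp only: rho.simps * shift phase1 phase2 of_real_add distrib_left exp_add mult_ac)
qed

definition alpha :: "real \<Rightarrow> int \<Rightarrow> real \<Rightarrow> real" where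
  "alpha q0 n \<epsilon> = exp (- \<epsilon> * of_int n * q0)"

definition beta :: "real \<Rightarrow> real \<Rightarrow> (real \<Rightarrow> real) \<Rightarrow> int \<Rightarrow> int \<Rightarrow> real \<Rightarrow> real" where
  "beta q0 L b m n \<epsilon> =
     - (2 * pi * of_int m * exp (- \<epsilon> * of_int n * q0)) / (b \<epsilon> * (exp (\<epsilon> * L) - exp (- \<epsilon> * L)))"

definition gamma :: "real \<Rightarrow> real \<Rightarrow> (real \<Rightarrow> real) \<Rightarrow> int \<Rightarrow> int \<Rightarrow> real \<Rightarrow> real" where
  "gamma q0 L b m n \<epsilon> =
     beta q0 L b m n \<epsilon> *
       (if alpha q0 n \<epsilon> = 1 then 1 else ln (alpha q0 n \<epsilon>) / (alpha q0 n \<epsilon> - 1))"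

definition Q :: "real \<Rightarrow> real \<Rightarrow> real" where
  "Q \<epsilon> x = exp (- (1 / 2) * \<epsilon> * x)"

definition ea_state ::
  "(real \<Rightarrow> real) \<Rightarrow> (real \<Rightarrow> real) \<Rightarrow> real \<Rightarrow> real \<Rightarrow> (real \<Rightarrow> complex) \<Rightarrow> int \<Rightarrow> int \<Rightarrow>
   real \<Rightarrow> real \<Rightarrow> complex" where
  "ea_state a b q0 L \<psi> n m \<epsilon> =
     rho \<epsilon> (a \<epsilon>) (b \<epsilon>) (alpha q0 n \<epsilon>, beta q0 L b m n \<epsilon>, gamma q0 L b m n \<epsilon>)
       (\<lambda>x. complex_of_real (Q \<epsilon> x) * \<psi> x)"

end

theory Submission
  imports Defs "HOL-Real_Asymp.Real_Asymp"
begin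

text \<open>
  With \<open>s = n q\<^sub>0\<close>, both states are unimodular phases times the translate \<open>\<psi>(x + s)\<close> (and the factor
  \<open>Q\<^sub>\<epsilon>(x + s) \<rightarrow> 1\<close>), so only the phases must be compared. Factoring \<open>b(\<epsilon>) \<beta> = O(1/\<epsilon>)\<close> out of the
  affine phase leaves \<open>(a/b) g + e\<^sup>-\<^sup>\<epsilon>\<^sup>x\<close> with \<open>g = ln \<alpha> / (\<alpha> - 1) = 1 + \<epsilon>s/2 + \<dots>\<close> and
  \<open>a/b = -1 - \<epsilon>B/A + \<dots>\<close>; the leading terms cancel and the first-order term is the Heisenberg phase.
  Norm convergence follows by dominated convergence, since \<open>Q\<^sub>\<epsilon> \<le> e\<^sup>L\<^sup>/\<^sup>2\<close> on the support of \<open>\<psi>\<close>.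
\<close>

section \<open>Translation invariance: Lebesgue measure, null sets, \<open>L2\<close>\<close>

lemma distr_lebesgue_shift: "distr lebesgue lebesgue (\<lambda>x. x + s) = (lebesgue :: real measure)"
proof -
  have "(lebesgue :: real measure) = density (distr lebesgue lebesgue (\<lambda>x. s + 1 * x)) (\<lambda>_. ennreal \<bar>1\<bar>)"
    by (rule lebesgue_real_affine) simp
  then show ?thesis
    by (simp add: density_1 add.commute)
qed

lemma measurable_lebesgue_shift: "(\<lambda>x::real. x + s) \<in> lebesgue \<rightarrow>\<^sub>M lebesgue"
  using lebesgue_affine_measurable[where c = "\<lambda>x::real. 1" and t = s] by (simp add: add.commute)

text \<open>Translation preserves the measure, so null sets pull back to null sets. This moves the
  support condition from \<open>\<psi>\<close> to its translates.\<close>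

lemma AE_lebesgue_shift:
  assumes "AE x in lebesgue. P x"
  shows "AE x in lebesgue. P (x + s :: real)"
  by (rule AE_distrD[OF measurable_lebesgue_shift]) (use assms in \<open>simp only: distr_lebesgue_shift\<close>)

lemma in_L2_shift:
  assumes "in_L2 f"
  shows "in_L2 (\<lambda>x. f (x + s))"
proof -
  have f: "f \<in> borel_measurable lebesgue" "integrable lebesgue (\<lambda>x. (norm (f x))\<^sup>2)"
    using assms by (auto simp: in_L2_def)
  have "(\<lambda>x. f (x + s)) \<in> borel_measurable lebesgue"
    using measurable_compose[OF measurable_lebesgue_shift f(1)] .
  moreover have "integrable lebesgue (\<lambda>x. (norm (f (x + s)))\<^sup>2)"
    using lebesgue_integrable_real_affine[OF f(2), of 1 s] by (simp add: add.commute)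
  ultimately show ?thesis
    by (simp add: in_L2_def)
qed

section \<open>Norm convergence of multiplication operators applied to a fixed function\<close>

lemma in_L2_mult:
  assumes f: "in_L2 f" and c: "c \<in> borel_measurable lebesgue"
    and bound: "AE x in lebesgue. norm (c x * f x) \<le> K * norm (f x)"
  shows "in_L2 (\<lambda>x. c x * f x)"
proof -
  have m [measurable]: "f \<in> borel_measurable lebesgue" "c \<in> borel_measurable lebesgue"
    using f c by (auto simp: in_L2_def)
  have i: "integrable lebesgue (\<lambda>x. K\<^sup>2 * (norm (f x))\<^sup>2)"
    using f by (auto simp: in_L2_def)
  have "integrable lebesgue (\<lambda>x. (norm (c x * f x))\<^sup>2)"
  proof (rule Bochner_Integration.integrable_bound[OF i])
    show "AE x in lebesgue. norm ((norm (c x * f x))\<^sup>2) \<le> norm (K\<^sup>2 * (norm (f x))\<^sup>2)"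
      using bound
    proof eventually_elim
      case (elim x)
      have "(norm (c x * f x))\<^sup>2 \<le> (K * norm (f x))\<^sup>2"
        by (intro power_mono elim norm_ge_zero)
      then show ?case
        by (simp add: power_mult_distrib)
    qed
  qed measurable
  then show ?thesis
    by (simp add: in_L2_def)
qed

text \<open>Dominated convergence: by the triangle inequality the squared difference is at most
  \<open>(2 * K)\<^sup>2 * (norm (f x))\<^sup>2\<close>, which is integrable. The bounds concern the
  products with \<open>f\<close>, not the multipliers, because \<open>Q \<epsilon>\<close> is
  unbounded on the line and only controlled where \<open>f\<close> lives.\<close>

lemma tendsto_L2_mult:
  fixes c :: "real \<Rightarrow> real \<Rightarrow> complex"
  assumes f: "in_L2 f"
    and c: "\<And>t. c t \<in> borel_measurable lebesgue" and d: "d \<in> borel_measurable lebesgue"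
    and c_bound: "\<forall>\<^sub>F t in at_right 0. AE x in lebesgue. norm (c t x * f x) \<le> K * norm (f x)"
    and d_bound: "AE x in lebesgue. norm (d x * f x) \<le> K * norm (f x)"
    and lim: "\<And>x. ((\<lambda>t. c t x) \<longlongrightarrow> d x) (at_right 0)"
  shows "tendsto_L2 (\<lambda>t x. c t x * f x) (\<lambda>x. d x * f x) (at_right 0)"
proof -
  have m [measurable]: "f \<in> borel_measurable lebesgue" "\<And>t. c t \<in> borel_measurable lebesgue"
    "d \<in> borel_measurable lebesgue"
    using f c d by (auto simp: in_L2_def)
  have in_c: "\<forall>\<^sub>F t in at_right 0. in_L2 (\<lambda>x. c t x * f x)"
    using c_bound by eventually_elim (rule in_L2_mult[OF f c])
  have in_d: "in_L2 (\<lambda>x. d x * f x)"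
    by (rule in_L2_mult[OF f d d_bound])
  define h where "h t x = (norm (c t x * f x - d x * f x))\<^sup>2" for t x
  \<comment> \<open>The substitution of \<open>inverse t\<close> for \<open>t\<close> turns the
    limit at \<open>0\<close> from the right into a limit at infinity, where dominated convergence
    for a real parameter applies.\<close>
  have "((\<lambda>t. \<integral>x. h (inverse t) x \<partial>lebesgue) \<longlongrightarrow> (\<integral>x. 0 \<partial>(lebesgue :: real measure))) at_top"
  proof (rule integral_dominated_convergence_at_top)
    show "integrable lebesgue (\<lambda>x. (2 * K)\<^sup>2 * (norm (f x))\<^sup>2)"
      using f by (auto simp: in_L2_def)
    show "AE x in lebesgue. ((\<lambda>t. h (inverse t) x) \<longlongrightarrow> 0) at_top"
    proof (rule AE_I2)
      fix x
      have "((\<lambda>t. h t x) \<longlongrightarrow> (norm (d x * f x - d x * f x))\<^sup>2) (at_right 0)"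
        unfolding h_def by (intro tendsto_intros lim)
      then show "((\<lambda>t. h (inverse t) x) \<longlongrightarrow> 0) at_top"
        by (simp add: filterlim_at_right_to_top)
    qed
    have "\<forall>\<^sub>F t in at_right 0. AE x in lebesgue. norm (h t x) \<le> (2 * K)\<^sup>2 * (norm (f x))\<^sup>2"
      using c_bound
    proof eventually_elim
      case (elim t)
      with d_bound show ?case
      proof eventually_elim
        case (elim x)
        have le: "norm (c t x * f x - d x * f x) \<le> 2 * K * norm (f x)"
          using norm_triangle_ineq4[of "c t x * f x" "d x * f x"] elim by linarith
        have "h t x \<le> (2 * K * norm (f x))\<^sup>2"
          unfolding h_def by (intro power_mono le norm_ge_zero)
        then show ?case
          by (simp add: h_def power_mult_distrib)
      qed
    qed
    then show "\<forall>\<^sub>F t in at_top. AE x in lebesgue. norm (h (inverse t) x) \<le> (2 * K)\<^sup>2 * (norm (f x))\<^sup>2"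
      by (simp add: at_right_to_top eventually_filtermap)
  qed (auto simp: h_def)
  then have "((\<lambda>t. \<integral>x. h t x \<partial>lebesgue) \<longlongrightarrow> 0) (at_right 0)"
    by (simp add: filterlim_at_right_to_top)
  then have "((\<lambda>t. norm_L2 (\<lambda>x. c t x * f x - d x * f x)) \<longlongrightarrow> sqrt 0) (at_right 0)"
    unfolding norm_L2_def h_def by (rule tendsto_real_sqrt)
  then show ?thesis
    using in_c in_d by (simp add: tendsto_L2_def)
qed

text \<open>Needed because the affine state takes its product form only for
  \<open>\<epsilon> > 0\<close>.\<close>

lemma tendsto_L2_cong:
  assumes "\<forall>\<^sub>F t in F. f t = f' t" and "tendsto_L2 f' g F"
  shows "tendsto_L2 f g F"
proof -
  have "\<forall>\<^sub>F t in F. in_L2 (f t)"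
    using assms unfolding tendsto_L2_def by (auto elim: eventually_elim2)
  moreover have "((\<lambda>t. norm_L2 (\<lambda>x. f t x - g x)) \<longlongrightarrow> 0) F"
  proof (rule Lim_transform_eventually)
    show "((\<lambda>t. norm_L2 (\<lambda>x. f' t x - g x)) \<longlongrightarrow> 0) F"
      using assms(2) by (simp add: tendsto_L2_def)
    show "\<forall>\<^sub>F t in F. norm_L2 (\<lambda>x. f' t x - g x) = norm_L2 (\<lambda>x. f t x - g x)"
      using assms(1) by eventually_elim simp
  qed
  ultimately show ?thesis
    using assms(2) by (simp add: tendsto_L2_def)
qed

section \<open>Asymptotics of the quotient of \<open>ln \<alpha>\<close> by
  \<open>\<alpha> - 1\<close>\<close>

definition log_ratio :: "real \<Rightarrow> real \<Rightarrow> real" where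
  "log_ratio s \<epsilon> = (if s = 0 then 1 else - \<epsilon> * s / (exp (- \<epsilon> * s) - 1))"

text \<open>This is the expansion y / (exp y - 1) = 1 - y/2 + ... at y = -\<epsilon>s.\<close>

lemma log_ratio_first_order:
  "((\<lambda>\<epsilon>. (log_ratio s \<epsilon> - 1) / \<epsilon>) \<longlongrightarrow> s / 2) (at_right 0)"
proof (cases "s = 0")
  case False
  \<comment> \<open>The sign of \<open>s\<close> is fixed so that \<open>real_asymp\<close> knows
    the signs of the coefficients in its expansions.\<close>
  then consider "s > 0" | "s < 0" by linarith
  then have "((\<lambda>\<epsilon>. (- \<epsilon> * s / (exp (- \<epsilon> * s) - 1) - 1) / \<epsilon>) \<longlongrightarrow> s / 2) (at_right 0)"
    by cases (real_asymp; simp add: field_simps)+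
  with False show ?thesis by (simp add: log_ratio_def)
qed (simp add: log_ratio_def)

lemma log_ratio_tendsto: "(log_ratio s \<longlongrightarrow> 1) (at_right 0)"
proof -
  have "((\<lambda>\<epsilon>. \<epsilon> * ((log_ratio s \<epsilon> - 1) / \<epsilon>) + 1) \<longlongrightarrow> 0 * (s / 2) + 1) (at_right 0)"
    by (intro tendsto_intros log_ratio_first_order)
  then have "((\<lambda>\<epsilon>. \<epsilon> * ((log_ratio s \<epsilon> - 1) / \<epsilon>) + 1) \<longlongrightarrow> 1) (at_right 0)"
    by simp
  then show ?thesis
    by (rule Lim_transform_eventually)
      (auto simp: eventually_at_right_field intro!: exI[of _ 1])
qed

text \<open>For \<open>\<epsilon> > 0\<close>, \<open>alpha q0 n \<epsilon> = 1\<close> holds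
  exactly when \<open>n q0 = 0\<close>, so the case distinction in \<open>gamma\<close> does not
  depend on \<open>\<epsilon>\<close>.\<close>

lemma gamma_eq:
  assumes "\<epsilon> > 0"
  shows "gamma q0 L b m n \<epsilon> = beta q0 L b m n \<epsilon> * log_ratio (of_int n * q0) \<epsilon>"
  using assms by (auto simp: gamma_def log_ratio_def alpha_def mult.assoc)

definition ea_phase ::
  "(real \<Rightarrow> real) \<Rightarrow> (real \<Rightarrow> real) \<Rightarrow> real \<Rightarrow> real \<Rightarrow> int \<Rightarrow> int \<Rightarrow> real \<Rightarrow> real \<Rightarrow> real" where
  "ea_phase a b q0 L n m \<epsilon> x =
     a \<epsilon> * gamma q0 L b m n \<epsilon> + b \<epsilon> * beta q0 L b m n \<epsilon> * exp (- \<epsilon> * x)"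

text \<open>The logarithm of \<open>alpha\<close> is linear in \<open>\<epsilon>\<close>, so the
  translation by \<open>ln \<alpha> / \<epsilon>\<close> is independent of \<open>\<epsilon>\<close>
  and agrees with the Heisenberg one.\<close>

lemma ea_state_eq:
  assumes "\<epsilon> > 0"
  shows "ea_state a b q0 L \<psi> n m \<epsilon> x =
    exp (\<i> * complex_of_real (ea_phase a b q0 L n m \<epsilon> x)) * complex_of_real (Q \<epsilon> (x + of_int n * q0)) *
      \<psi> (x + of_int n * q0)"
proof -
  have "x - ln (alpha q0 n \<epsilon>) / \<epsilon> = x + of_int n * q0"
    using assms by (simp add: alpha_def)
  then show ?thesis
    by (simp only: ea_state_def rho.simps ea_phase_def of_real_add distrib_left exp_add mult.assoc)
qed

text \<open>The phase is a product \<open>u * v\<close>: \<open>u\<close> is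
  \<open>\<epsilon> b \<beta>\<close>, tending to -m pi / L, and \<open>v\<close> is the remaining
  factor divided by \<open>\<epsilon>\<close>, tending to -(B/A + s/2 + x).\<close>

lemma ea_phase_tendsto:
  assumes A: "A \<noteq> 0" and AB: "a0 + b0 = B"
    and a: "\<And>\<epsilon>. \<epsilon> \<in> {0<..1} \<Longrightarrow> a \<epsilon> = a0 + A / \<epsilon>"
    and b: "\<And>\<epsilon>. \<epsilon> \<in> {0<..1} \<Longrightarrow> b \<epsilon> = b0 - A / \<epsilon>"
    and b_nz: "\<And>\<epsilon>. \<epsilon> \<in> {0<..1} \<Longrightarrow> b \<epsilon> \<noteq> 0"
    and L: "L > 0"
  shows "((\<lambda>\<epsilon>. ea_phase a b q0 L n m \<epsilon> x) \<longlongrightarrow>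
    of_int m * pi / (A * L) * (A * (of_int n * q0 / 2 + x) + B)) (at_right 0)"
proof -
  define s where "s = of_int n * q0"
  define u where "u \<epsilon> = - (2 * pi * of_int m * exp (- \<epsilon> * s)) / ((exp (\<epsilon> * L) - exp (- \<epsilon> * L)) / \<epsilon>)" for \<epsilon>
  \<comment> \<open>With g = \<open>log_ratio s \<epsilon>\<close>, the factor (a/b) g +
    exp(-\<epsilon>x) is regrouped as (a/b + 1) g - (g - 1) + (exp(-\<epsilon>x) - 1). Each summand
    is of order \<epsilon>, so after division each has a finite limit.\<close>
  define v where "v \<epsilon> = B / (b0 * \<epsilon> - A) * log_ratio s \<epsilon> - (log_ratio s \<epsilon> - 1) / \<epsilon>
      + (exp (- \<epsilon> * x) - 1) / \<epsilon>" for \<epsilon>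
  have D: "((\<lambda>\<epsilon>. (exp (\<epsilon> * L) - exp (- \<epsilon> * L)) / \<epsilon>) \<longlongrightarrow> 2 * L) (at_right 0)"
    using L by real_asymp
  have E: "((\<lambda>\<epsilon>. (exp (- \<epsilon> * x) - 1) / \<epsilon>) \<longlongrightarrow> - x) (at_right 0)"
    by real_asymp
  have "(u \<longlongrightarrow> - (2 * pi * of_int m * exp (- 0 * s)) / (2 * L)) (at_right 0)"
    unfolding u_def using L by (intro tendsto_intros D) auto
  moreover have "(v \<longlongrightarrow> B / (b0 * 0 - A) * 1 - s / 2 + - x) (at_right 0)"
    unfolding v_def using A
    by (intro tendsto_intros log_ratio_tendsto log_ratio_first_order E) auto
  ultimately have "((\<lambda>\<epsilon>. u \<epsilon> * v \<epsilon>) \<longlongrightarrow>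
      - (2 * pi * of_int m * exp (- 0 * s)) / (2 * L) * (B / (b0 * 0 - A) * 1 - s / 2 + - x)) (at_right 0)"
    by (rule tendsto_mult)
  moreover have "- (2 * pi * of_int m * exp (- 0 * s)) / (2 * L) * (B / (b0 * 0 - A) * 1 - s / 2 + - x)
      = of_int m * pi / (A * L) * (A * (s / 2 + x) + B)"
    using A L by (simp add: field_simps)
  moreover have "\<forall>\<^sub>F \<epsilon> in at_right 0. u \<epsilon> * v \<epsilon> = ea_phase a b q0 L n m \<epsilon> x"
  proof -
    have "\<forall>\<^sub>F \<epsilon> in at_right 0. \<epsilon> \<in> {0<..1::real}"
      by (auto simp: eventually_at_right_field intro!: exI[of _ 1])
    then show ?thesis
    proof eventually_elim
      case (elim \<epsilon>)
      then have pos: "\<epsilon> > 0" by simp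
      have nz: "b \<epsilon> \<noteq> 0" using b_nz elim by blast
      have den: "b \<epsilon> * \<epsilon> = b0 * \<epsilon> - A"
        using pos by (simp add: b[OF elim] left_diff_distrib)
      \<comment> \<open>The singular terms of \<open>a \<epsilon>\<close> and
        \<open>b \<epsilon>\<close> cancel in the sum, leaving a + b = B and hence a/b + 1 =
        B/b.\<close>
      have B_eq: "B / (b0 * \<epsilon> - A) = (a \<epsilon> / b \<epsilon> + 1) / \<epsilon>"
        using pos nz unfolding den[symmetric]
        by (simp add: field_simps a[OF elim] b[OF elim] flip: AB)
      then have v_eq: "\<epsilon> * v \<epsilon> = a \<epsilon> / b \<epsilon> * log_ratio s \<epsilon> + exp (- \<epsilon> * x)"
        using pos unfolding v_def B_eq by (simp add: field_simps)
      have u_eq: "u \<epsilon> = \<epsilon> * (b \<epsilon> * beta q0 L b m n \<epsilon>)"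
        using nz by (simp add: u_def beta_def s_def mult.assoc)
      have "u \<epsilon> * v \<epsilon> = b \<epsilon> * beta q0 L b m n \<epsilon> * (\<epsilon> * v \<epsilon>)"
        by (simp add: u_eq)
      also have "\<dots> = ea_phase a b q0 L n m \<epsilon> x"
        unfolding v_eq ea_phase_def gamma_eq[OF pos] s_def[symmetric] using nz
        by (simp add: distrib_left)
      finally show ?case .
    qed
  qed
  ultimately show ?thesis
    unfolding s_def by (auto intro: Lim_transform_eventually)
qed

section \<open>Pointwise and norm convergence of the states\<close>

theorem mainTheorem11:
  fixes A B a0 b0 L p0 q0 chi :: real
    and a b :: "real \<Rightarrow> real"
    and \<psi> :: "real \<Rightarrow> complex"
  assumes "A \<noteq> 0" and "a0 + b0 = B"
    and "\<And>\<epsilon>. \<epsilon> \<in> {0<..1} \<Longrightarrow> a \<epsilon> = a0 + A / \<epsilon>"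
    and "\<And>\<epsilon>. \<epsilon> \<in> {0<..1} \<Longrightarrow> b \<epsilon> = b0 - A / \<epsilon>"
    and "\<And>\<epsilon>. \<epsilon> \<in> {0<..1} \<Longrightarrow> b \<epsilon> \<noteq> 0"
    and "L > 0"
    and "in_L2 \<psi>" and "\<not> (AE x in lebesgue. \<psi> x = 0)"
    and "ess_supported_in \<psi> {-L..L}"
    and "p0 = pi / (A * L)" and "\<bar>q0 * p0\<bar> < 2 * pi"
    and "chi > 0"
    and "\<And>x. ((\<lambda>n::int. (norm (\<psi> (x + of_int n * q0)))\<^sup>2) has_sum chi) UNIV"
  shows "(\<forall>x n m. ((\<lambda>\<epsilon>. ea_state a b q0 L \<psi> n m \<epsilon> x)
              \<longlongrightarrow> heis_state A B q0 p0 \<psi> n m x) (at_right 0)) \<and>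
         (\<forall>n m. tendsto_L2 (ea_state a b q0 L \<psi> n m) (heis_state A B q0 p0 \<psi> n m) (at_right 0))"
proof (intro conjI allI)
  \<comment> \<open>Both states are multipliers, \<open>c\<close> and \<open>d\<close>, applied to
    the same translate of \<open>\<psi>\<close>; both claims rest on the pointwise limit of
    \<open>c\<close>.\<close>
  define c where "c n m \<epsilon> x = exp (\<i> * complex_of_real (ea_phase a b q0 L n m \<epsilon> x)) *
    complex_of_real (Q \<epsilon> (x + of_int n * q0))" for n m \<epsilon> x
  define d where "d n m x = exp (\<i> * complex_of_real (A * (of_int n * q0 * (of_int m * p0) / 2 +
    x * (of_int m * p0)) + B * (of_int m * p0)))" for n m :: int and x :: real
  have ea: "\<forall>\<^sub>F \<epsilon> in at_right 0.
      ea_state a b q0 L \<psi> n m \<epsilon> = (\<lambda>x. c n m \<epsilon> x * \<psi> (x + of_int n * q0))" for n m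
    using eventually_at_right_less
    by eventually_elim (simp add: ea_state_eq c_def fun_eq_iff)
  have heis: "heis_state A B q0 p0 \<psi> n m = (\<lambda>x. d n m x * \<psi> (x + of_int n * q0))" for n m
    by (simp add: heis_state_def d_def fun_eq_iff add.commute)
  have lim: "((\<lambda>\<epsilon>. c n m \<epsilon> x) \<longlongrightarrow> d n m x) (at_right 0)" for n m x
  proof -
    \<comment> \<open>The choice of \<open>p0\<close> makes \<open>m * pi / (A * L)\<close> equal to
      \<open>m * p0\<close>, the last coordinate of the Heisenberg element.\<close>
    have phase: "of_int m * pi / (A * L) * (A * (of_int n * q0 / 2 + x) + B) =
        A * (of_int n * q0 * (of_int m * p0) / 2 + x * (of_int m * p0)) + B * (of_int m * p0)"
      by (simp add: \<open>p0 = pi / (A * L)\<close> algebra_simps add_divide_distrib)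
    have "((\<lambda>\<epsilon>. Q \<epsilon> (x + of_int n * q0)) \<longlongrightarrow> exp (- (1 / 2) * 0 * (x + of_int n * q0))) (at_right 0)"
      unfolding Q_def by (intro tendsto_intros)
    then have Q: "((\<lambda>\<epsilon>. Q \<epsilon> (x + of_int n * q0)) \<longlongrightarrow> 1) (at_right 0)"
      by simp
    have "((\<lambda>\<epsilon>. c n m \<epsilon> x) \<longlongrightarrow> d n m x * complex_of_real 1) (at_right 0)"
      unfolding c_def d_def
      by (intro tendsto_intros Q
        ea_phase_tendsto[OF assms(1-6), where ?q0.0 = q0 and n = n and m = m and x = x, unfolded phase])
    then show ?thesis
      by simp
  qed
  show "((\<lambda>\<epsilon>. ea_state a b q0 L \<psi> n m \<epsilon> x) \<longlongrightarrow> heis_state A B q0 p0 \<psi> n m x) (at_right 0)" for x n m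
  proof (rule Lim_transform_eventually)
    show "((\<lambda>\<epsilon>. c n m \<epsilon> x * \<psi> (x + of_int n * q0)) \<longlongrightarrow> heis_state A B q0 p0 \<psi> n m x) (at_right 0)"
      unfolding heis by (intro tendsto_intros lim)
    show "\<forall>\<^sub>F \<epsilon> in at_right 0. c n m \<epsilon> x * \<psi> (x + of_int n * q0) = ea_state a b q0 L \<psi> n m \<epsilon> x"
      using ea[of n m] by eventually_elim simp
  qed
  show "tendsto_L2 (ea_state a b q0 L \<psi> n m) (heis_state A B q0 p0 \<psi> n m) (at_right 0)" for n m
  \<comment> \<open>\<open>exp (L / 2)\<close> bounds \<open>Q \<epsilon> y\<close> for all
    \<open>\<epsilon>\<close> in \<open>{0<..1}\<close> and y in \<open>{-L..L}\<close>, and also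
    the modulus 1 of \<open>d\<close>.\<close>
  proof (rule tendsto_L2_cong[OF ea], unfold heis, rule tendsto_L2_mult[where K = "exp (L / 2)"])
    show "in_L2 (\<lambda>x. \<psi> (x + of_int n * q0))"
      by (rule in_L2_shift[OF \<open>in_L2 \<psi>\<close>])
    have "continuous_on UNIV (c n m \<epsilon>)" for \<epsilon>
      unfolding c_def ea_phase_def Q_def by (intro continuous_intros)
    then show "c n m \<epsilon> \<in> borel_measurable lebesgue" for \<epsilon>
      by (intro measurable_completion) (simp add: borel_measurable_continuous_onI)
    have "continuous_on UNIV (d n m)"
      unfolding d_def by (intro continuous_intros)
    then show "d n m \<in> borel_measurable lebesgue"
      by (intro measurable_completion) (simp add: borel_measurable_continuous_onI)
    have "norm (d n m x) = 1" for x
      unfolding d_def by (rule norm_exp_i_times)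
    moreover have "1 \<le> exp (L / 2)"
      using \<open>L > 0\<close> by simp
    ultimately show "AE x in lebesgue. norm (d n m x * \<psi> (x + of_int n * q0)) \<le>
        exp (L / 2) * norm (\<psi> (x + of_int n * q0))"
      by (intro AE_I2) (simp only: norm_mult mult_right_mono norm_ge_zero)
    have supp: "AE x in lebesgue. x + of_int n * q0 \<notin> {-L..L} \<longrightarrow> \<psi> (x + of_int n * q0) = 0"
      using assms(9) unfolding ess_supported_in_def by (rule AE_lebesgue_shift)
    have "\<forall>\<^sub>F \<epsilon> in at_right 0. \<epsilon> \<in> {0<..1::real}"
      by (auto simp: eventually_at_right_field intro!: exI[of _ 1])
    then show "\<forall>\<^sub>F \<epsilon> in at_right 0. AE x in lebesgue.
        norm (c n m \<epsilon> x * \<psi> (x + of_int n * q0)) \<le> exp (L / 2) * norm (\<psi> (x + of_int n * q0))"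
    proof eventually_elim
      case (elim \<epsilon>)
      \<comment> \<open>The phase is unimodular, so only \<open>Q\<close> must be bounded: on the
        support by \<open>Q_le\<close>, while off it the product vanishes almost everywhere.\<close>
      have norm_c: "norm (c n m \<epsilon> x) = Q \<epsilon> (x + of_int n * q0)" for x
        unfolding c_def norm_mult norm_exp_i_times by (simp add: Q_def)
      have Q_le: "Q \<epsilon> y \<le> exp (L / 2)" if "y \<in> {-L..L}" for y
      proof -
        have "\<epsilon> * (- y) \<le> 1 * L"
          using that elim \<open>L > 0\<close>
          by (metis atLeastAtMost_iff greaterThanAtMost_iff less_imp_le minus_le_iff mult_left_mono
            mult_right_mono order_trans)
        then show ?thesis by (simp add: Q_def)
      qed
      show ?case
        using supp
      proof eventually_elim
        case (elim x)
        show ?case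
        proof (cases "x + of_int n * q0 \<in> {-L..L}")
          case True
          then show ?thesis
            unfolding norm_mult norm_c by (intro mult_right_mono Q_le) auto
        next
          case False
          with elim show ?thesis by simp
        qed
      qed
    qed
    show "((\<lambda>\<epsilon>. c n m \<epsilon> x) \<longlongrightarrow> d n m x) (at_right 0)" for x
      by (rule lim)
  qed
qed

end
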